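(* Let $N\ge3$. Let $\mathbf d_n,\mathbf f_n,\mathbf g_{i,n},\mathbf h_{i,n},\mathbf r_n,\mathbf s_n\in\mathbb Z^{4N}$ ($1\le i\le N-2$, $n\ge 0$) be the sequences of degree vectors determined by the following $(\max,+)$ system and initial data. Writing $\mathbf w_{2,n}=\mathbf f_n$, $\mathbf w_{k,n}=\mathbf g_{k-2,n}$ for $3\le k\le N$, and $\mathbf w_{k,n}=\mathbf h_{2N-1-k,n}$ for $N+1\le k\le 2N-2$, the system is (for $n\ge0$, with componentwise $\max$) $$\begin{aligned} \mathbf d_{n+2N+1}+\mathbf d_n&=\max(\mathbf d_{n+2N-1}+\mathbf d_{n+2},\ \mathbf w_{2,n}),\\ \mathbf w_{2,n+1}+\mathbf w_{2,n}&=\max(\mathbf d_{n+2N-1}+\mathbf d_{n+2N}+\mathbf d_{n+2}+\mathbf d_{n+3},\ \mathbf w_{3,n}+\mathbf d_{n+2N+1}+\mathbf d_{n+1}),\\ \mathbf w_{k,n+1}+\mathbf w_{k,n}&=\max(\mathbf d_{n+2N-1}+\mathbf d_{n+2N}+\mathbf d_{n+k}+\mathbf d_{n+k+1},\ \mathbf w_{k-1,n+1}+\mathbf w_{k+1,n})\quad(3\le k\le2N-3),\\ \mathbf w_{2N-2,n+1}+\mathbf w_{2N-2,n}&=\max(2\mathbf d_{n+2N-1}+\mathbf d_{n+2N}+\mathbf d_{n+2N-2},\ \mathbf w_{2N-3,n+1}+\mathbf r_n+\mathbf s_n),\\ \mathbf s_{n+1}+\mathbf r_n&=\max(\mathbf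 d_{n+2N-1}+\mathbf d_{n+2N},\ \mathbf w_{2N-2,n+1}),\\ \mathbf r_{n+1}+\mathbf s_n&=\max(\mathbf d_{n+2N-1}+\mathbf d_{n+2N},\ \mathbf w_{2N-2,n+1}), \end{aligned}$$ with initial data $$(\mathbf h_{N-2,0},\mathbf h_{N-3,0},\dots,\mathbf h_{1,0},\mathbf r_0,\mathbf s_0,\mathbf d_0,\dots,\mathbf d_{2N},\mathbf f_0,\mathbf g_{1,0},\dots,\mathbf g_{N-2,0})=-I,$$ where $I$ is the $4N\times4N$ identity matrix. Then, as $n\to\infty$, for $1\le i\le N-2$, $$\mathbf d_n=\frac{n^2}{8N^2-4N}\mathbf a+O(n),\quad \mathbf r_n=\frac{n^2}{8N^2-4N}\mathbf a+O(n),\quad \mathbf s_n=\frac{n^2}{8N^2-4N}\mathbf a+O(n),$$ $$\mathbf f_n=\frac{n^2}{4N^2-2N}\mathbf a+O(n),\quad \mathbf h_{i,n}=\frac{n^2}{4N^2-2N}\mathbf a+O(n),\quad \mathbf g_{i,n}=\frac{n^2}{4N^2-2N}\mathbf a+O(n),$$ where $\mathbf a=(a_k)_{1\le k\le 4N}$ with $a_k=2$ for $k\in\{1,\dots,N-2\}\cup\{3N+2,\dots,4N\}$ and $a_k=1$ for $k\in\{N-1,N,\dots,3N+1\}$.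
   Context: The vectors $\mathbf d_n,\mathbf f_n,\mathbf g_{i,n},\mathbf h_{i,n},\mathbf r_n,\mathbf s_n$ are the denominator exponent vectors of the cluster variables $\tau_n,\chi_n,\eta_{i,n},\xi_{i,n},r_n,s_n$, respectively, generated by iterating the cluster map obtained by Laurentification of the deformed type $D_{2N}$ map, written as Laurent polynomials in the initial cluster $(\xi_{N-2,0},\dots,\xi_{1,0},r_0,s_0,\tau_0,\dots,\tau_{2N},\chi_0,\eta_{1,0},\dots,\eta_{N-2,0})$. For the claim it suffices to regard them as the sequences determined by the stated system and initial data. $O(n)$ is understood componentwise. *)

theory Defs
  imports "Jordan_Normal_Form.Matrix" "HOL-Library.Landau_Symbols"
begin

definition vec_max :: "int vec \<Rightarrow> int vec \<Rightarrow> int vec" where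
  "vec_max u v = vec (dim_vec u) (\<lambda>j. max (u $ j) (v $ j))"

(* The ordered list h_{N-2,0}, ..., h_{1,0}, r_0, s_0, d_0, ..., d_{2N}, f_0, g_{1,0}, ..., g_{N-2,0}
   of 4N vectors; g i n and h i n stand for g_{i,n} and h_{i,n}. *)
definition initial_vecs ::
  "nat \<Rightarrow> (nat \<Rightarrow> int vec) \<Rightarrow> (nat \<Rightarrow> int vec) \<Rightarrow> (nat \<Rightarrow> nat \<Rightarrow> int vec) \<Rightarrow> (nat \<Rightarrow> nat \<Rightarrow> int vec)
    \<Rightarrow> (nat \<Rightarrow> int vec) \<Rightarrow> (nat \<Rightarrow> int vec) \<Rightarrow> int vec list" where
  "initial_vecs N d f g h r s =
     map (\<lambda>i. h i 0) (rev [1..<N-1]) @ [r 0, s 0] @ map d [0..<2*N+1]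
     @ [f 0] @ map (\<lambda>i. g i 0) [1..<N-1]"

(* vec is indexed from 0, so the entry a_k of the mathematical vector sits at position k - 1. *)
definition a_vec :: "nat \<Rightarrow> real vec" where
  "a_vec N = vec (4*N) (\<lambda>j. if j + 1 \<in> {1..N-2} \<union> {3*N+2..4*N} then 2 else 1)"

definition vec_bigo :: "nat \<Rightarrow> (nat \<Rightarrow> real) \<Rightarrow> (nat \<Rightarrow> real vec) set" where
  "vec_bigo m b = {u. (\<forall>n. u n \<in> carrier_vec m) \<and> (\<forall>j<m. (\<lambda>n. u n $ j) \<in> O(b))}"

end

(* Componentwise, X_1 = d(n+2N) + d(n) - d(n+2N-1) - d(n+1), X_k = w_k(n) - d(n+2N-1) - d(n+k),
   r(n) - d(n+2N-1) and s(n) - d(n+2N-1) satisfy the tropical frieze recurrence of type D_2N, which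
   no longer involves d. The unit initial vectors give initial states equal to minus a unit vector
   or lying in the orbit of minus the first unit vector; all these orbits are explicit, have
   period 2N, and the sum of X_1 over one period is a_k. Since X_1(n) is the increment of
   E(n) = d(n+2N-1) - d(n), we get E(n) = n a_k / 2N + O(1), and telescoping in steps of 2N-1 gives
   d(n) = n^2 a_k / (2 * 2N * (2N-1)) + O(n). The other sequences differ from one or two shifts
   of d by bounded terms. *)
theory Submission
  imports Defs
begin

section \<open>Tropical friezes of type D as a deterministic dynamical system\<close>

text \<open>The Dynkin diagram has M + 2 nodes: the chain 1, ..., M and the two spin nodes M + 1 (for r)
  and M + 2 (for s), both attached to M. A step exchanges the spin nodes.\<close>

definition frieze_step :: "nat \<Rightarrow> (nat \<Rightarrow> int) \<Rightarrow> (nat \<Rightarrow> int) \<Rightarrow> bool" where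
  "frieze_step M u v \<longleftrightarrow>
     v 1 + u 1 = max 0 (u 2) \<and>
     (\<forall>k\<in>{2..<M}. v k + u k = max 0 (v (k-1) + u (k+1))) \<and>
     v M + u M = max 0 (v (M-1) + u (M+1) + u (M+2)) \<and>
     v (M+2) + u (M+1) = max 0 (v M) \<and>
     v (M+1) + u (M+2) = max 0 (v M)"

lemma frieze_stepD:
  assumes "frieze_step M u v"
  shows "v 1 = max 0 (u 2) - u 1"
    and "k \<in> {2..<M} \<Longrightarrow> v k = max 0 (v (k-1) + u (k+1)) - u k"
    and "v M = max 0 (v (M-1) + u (M+1) + u (M+2)) - u M"
    and "v (M+1) = max 0 (v M) - u (M+2)"
    and "v (M+2) = max 0 (v M) - u (M+1)"
  using assms unfolding frieze_step_def by (metis add_diff_cancel_right')+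

text \<open>The new state is computed node by node: \<open>v 1\<close> needs only old values, each
  further chain node needs its new left neighbour and old right neighbours, and the spin nodes need
  \<open>v M\<close>. Agreement is asked only on the nodes 1, ..., M + 2, since values elsewhere are
  arbitrary.\<close>

lemma frieze_step_unique:
  assumes "M \<ge> 2" "frieze_step M u v" "frieze_step M u' v'"
    and eq: "\<And>k. k \<in> {1..M+2} \<Longrightarrow> u k = u' k"
    and "k \<in> {1..M+2}"
  shows "v k = v' k"
proof -
  note v = frieze_stepD[OF assms(2)] and v' = frieze_stepD[OF assms(3)]
  have *: "v k = v' k" if "1 \<le> k" "k \<le> M" for k
    using that
  proof (induction k rule: dec_induct)
    case base
    show ?case unfolding v(1) v'(1) using assms(1) by (simp add: eq)
  next
    case (step k)
    show ?case
    proof (cases "Suc k = M")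
      case True
      then have "M - 1 = k" by simp
      then show ?thesis using step assms(1) unfolding True v(3) v'(3) by (simp add: eq)
    next
      case False
      then have "Suc k \<in> {2..<M}" using step by auto
      then show ?thesis using v(2)[of "Suc k"] v'(2)[of "Suc k"] step by (simp add: eq)
    qed
  qed
  consider "k \<le> M" | "k = M+1" | "k = M+2" using assms(5) by force
  then show ?thesis
  proof cases
    case 1
    then show ?thesis using * assms(5) by simp
  next
    case 2
    then show ?thesis using *[of M] assms(1) v(4) v'(4) by (simp add: eq)
  next
    case 3
    then show ?thesis using *[of M] assms(1) v(5) v'(5) by (simp add: eq)
  qed
qed

text \<open>By determinism, a trajectory that starts on a cycle stays on it. The offset
  \<open>t0\<close> lets it enter the cycle at any time.\<close>

lemma frieze_orbit:
  assumes "M \<ge> 2" "\<And>n. frieze_step M (X n) (X (Suc n))"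
    and U: "\<And>t. t < p \<Longrightarrow> frieze_step M (U t) (U (Suc t mod p))"
    and "p > 0"
    and init: "\<And>k. k \<in> {1..M+2} \<Longrightarrow> X 0 k = U (t0 mod p) k"
    and k: "k \<in> {1..M+2}"
  shows "X n k = U ((n + t0) mod p) k"
  using k
proof (induction n arbitrary: k)
  case 0
  then show ?case using init by simp
next
  case (Suc n)
  have "frieze_step M (U ((n + t0) mod p)) (U (Suc ((n + t0) mod p) mod p))"
    by (rule U) (use \<open>p > 0\<close> in simp)
  then have step: "frieze_step M (U ((n + t0) mod p)) (U ((Suc n + t0) mod p))"
    unfolding mod_Suc_eq add_Suc .
  show ?case
    by (rule frieze_step_unique[OF assms(1) assms(2) step Suc.IH Suc.prems])
qed

section \<open>Explicit periodic orbits and their period sums at node 1\<close>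

text \<open>The orbits of minus the unit vector at node 1, at a spin node j, and at an inner node j;
  t is the time in a period of length M + 2.\<close>

definition end_orbit :: "nat \<Rightarrow> nat \<Rightarrow> nat \<Rightarrow> int" where
  "end_orbit M t k =
     (if t = 0 then - of_bool (k = 1) else if t = 1 then 1 else of_bool (k + t = M + 2))"

definition spin_orbit :: "nat \<Rightarrow> nat \<Rightarrow> nat \<Rightarrow> nat \<Rightarrow> int" where
  "spin_orbit M j t k =
     (if t = 0 then - of_bool (k = j)
      else of_bool (k > M \<and> k \<noteq> j) + of_bool (M + 2 \<le> k + t \<and> k \<le> M))"

definition inner_orbit :: "nat \<Rightarrow> nat \<Rightarrow> nat \<Rightarrow> nat \<Rightarrow> int" where
  "inner_orbit M j t k =
     (if t = 0 then - of_bool (k = j)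
      else if t \<le> j then of_bool (j < k + t) + of_bool (M + 2 \<le> k + t \<and> k \<le> M)
      else of_bool (M + 2 \<le> k + t \<and> k + t \<le> M + 1 + j \<and> k \<le> M))"

lemma frieze_step_end_orbit:
  assumes "M \<ge> 2" "t < M + 2"
  shows "frieze_step M (end_orbit M t) (end_orbit M (Suc t mod (M + 2)))"
proof -
  consider "t = 0" | "t = 1" | "1 < t" "t < M + 1" | "t = M + 1" using assms by linarith
  then show ?thesis
  proof cases
    case 3
    then have "Suc t mod (M + 2) = Suc t" by simp
    then show ?thesis using 3 assms(1) unfolding frieze_step_def end_orbit_def by auto
  qed (use assms(1) in \<open>auto simp: frieze_step_def end_orbit_def\<close>)
qed

lemma frieze_step_spin_orbit:
  assumes "M \<ge> 2" "t < M + 2" "j \<in> {M+1, M+2}"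
  shows "frieze_step M (spin_orbit M j t) (spin_orbit M j (Suc t mod (M + 2)))"
proof -
  consider "t = 0" | "1 \<le> t" "t < M + 1" | "t = M + 1" using assms by linarith
  then show ?thesis
  proof cases
    case 2
    then have "Suc t mod (M + 2) = Suc t" by simp
    then show ?thesis using 2 assms(1,3) unfolding frieze_step_def spin_orbit_def by auto
  qed (use assms(1,3) in \<open>auto simp: frieze_step_def spin_orbit_def\<close>)
qed

lemma frieze_step_inner_orbit:
  assumes "M \<ge> 2" "t < M + 2" "j \<in> {2..M}"
  shows "frieze_step M (inner_orbit M j t) (inner_orbit M j (Suc t mod (M + 2)))"
proof -
  \<comment> \<open>The formula changes after time 0 and after time \<open>j\<close>, so the steps
    across these times are treated apart, as is the return from time \<open>M + 1\<close> to time
    0.\<close>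
  consider "t = 0" | "1 \<le> t" "t < j" | "t = j" | "j < t" "t < M + 1" | "t = M + 1"
    using assms by linarith
  then show ?thesis
  proof cases
    case 2
    then have "Suc t mod (M + 2) = Suc t" using assms(3) by simp
    then show ?thesis using 2 assms(1,3) unfolding frieze_step_def inner_orbit_def by auto
  next
    case 3
    then have "Suc t mod (M + 2) = Suc t" using assms(3) by simp
    then show ?thesis using 3 assms(1,3) unfolding frieze_step_def inner_orbit_def by auto
  next
    case 4
    then have "Suc t mod (M + 2) = Suc t" by simp
    then show ?thesis using 4 assms(1,3) unfolding frieze_step_def inner_orbit_def by auto
  qed (use assms(1,3) in \<open>auto simp: frieze_step_def inner_orbit_def\<close>)
qed

text \<open>Node 1 takes the value -1 at time 0, the value 1 at times 1 and \<open>M + 1\<close>,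
  and 0 otherwise. The three period sums become the entries of \<open>a_vec\<close>.\<close>

lemma sum_end_orbit:
  assumes "M \<ge> 2"
  shows "(\<Sum>t<M+2. end_orbit M t 1) = 1"
proof -
  have "(\<Sum>t<M+2. end_orbit M t 1) = (\<Sum>t\<in>{0,1,M+1}. end_orbit M t 1)"
    using assms by (intro sum.mono_neutral_right) (auto simp: end_orbit_def)
  then show ?thesis using assms by (simp add: end_orbit_def)
qed

text \<open>Node 1 is nonzero only at time \<open>M + 1\<close>, where it is 1.\<close>

lemma sum_spin_orbit:
  assumes "M \<ge> 2" "j > M"
  shows "(\<Sum>t<M+2. spin_orbit M j t 1) = 1"
proof -
  have "(\<Sum>t<M+2. spin_orbit M j t 1) = (\<Sum>t\<in>{M+1}. spin_orbit M j t 1)"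
    using assms by (intro sum.mono_neutral_right) (auto simp: spin_orbit_def)
  then show ?thesis using assms by (simp add: spin_orbit_def)
qed

text \<open>Node 1 is 1 at the two times \<open>j\<close> and \<open>M + 1\<close>, and 0
  otherwise.\<close>

lemma sum_inner_orbit:
  assumes "j \<in> {2..M}"
  shows "(\<Sum>t<M+2. inner_orbit M j t 1) = 2"
proof -
  have "(\<Sum>t<M+2. inner_orbit M j t 1) = (\<Sum>t\<in>{j,M+1}. inner_orbit M j t 1)"
    using assms by (intro sum.mono_neutral_right) (auto simp: inner_orbit_def)
  then show ?thesis using assms by (simp add: inner_orbit_def)
qed

lemma orbit_bounded:
  "\<bar>end_orbit M t k\<bar> \<le> 2" "\<bar>spin_orbit M j t k\<bar> \<le> 2" "\<bar>inner_orbit M j t k\<bar> \<le> 2"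
  by (auto simp: end_orbit_def spin_orbit_def inner_orbit_def of_bool_def)

section \<open>Quadratic growth with a linear error\<close>

text \<open>An explicit bound for all n, rather than a Landau set, keeps sums, shifts and inductions
  elementary; \<open>quad_growth_bigo\<close> converts it at the end.\<close>

definition quad_growth :: "real \<Rightarrow> (nat \<Rightarrow> int) \<Rightarrow> bool" where
  "quad_growth \<alpha> f \<longleftrightarrow> (\<exists>A B. \<forall>n. \<bar>of_int (f n) - \<alpha> * (real n)\<^sup>2\<bar> \<le> A + B * real n)"

lemma quad_growth_add:
  assumes "quad_growth \<alpha> f" "quad_growth \<beta> g"
  shows "quad_growth (\<alpha> + \<beta>) (\<lambda>n. f n + g n)"
proof -
  obtain A B A' B' where
    *: "\<And>n. \<bar>of_int (f n) - \<alpha> * (real n)\<^sup>2\<bar> \<le> A + B * real n"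
    "\<And>n. \<bar>of_int (g n) - \<beta> * (real n)\<^sup>2\<bar> \<le> A' + B' * real n"
    using assms unfolding quad_growth_def by blast
  have "\<bar>of_int (f n + g n) - (\<alpha> + \<beta>) * (real n)\<^sup>2\<bar> \<le> (A + A') + (B + B') * real n" for n
    using *[of n] by (simp add: algebra_simps)
  then show ?thesis unfolding quad_growth_def by blast
qed

lemma quad_growth_bounded:
  assumes "\<And>n. \<bar>f n\<bar> \<le> C"
  shows "quad_growth 0 f"
  unfolding quad_growth_def
proof (intro exI allI)
  show "\<bar>of_int (f n) - 0 * (real n)\<^sup>2\<bar> \<le> of_int C + 0 * real n" for n
    using assms[of n] by simp
qed

text \<open>The squares of n + m and n differ by 2nm + m^2, which is linear in n and goes into the
  error.\<close>

lemma quad_growth_shift: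
  assumes "quad_growth \<alpha> f"
  shows "quad_growth \<alpha> (\<lambda>n. f (n + m))"
proof -
  obtain A B where AB: "\<And>n. \<bar>of_int (f n) - \<alpha> * (real n)\<^sup>2\<bar> \<le> A + B * real n"
    using assms by (auto simp: quad_growth_def)
  show ?thesis
    unfolding quad_growth_def
  proof (intro exI allI)
    fix n
    have "of_int (f (n+m)) - \<alpha> * (real n)\<^sup>2
        = (of_int (f (n+m)) - \<alpha> * (real (n+m))\<^sup>2) + \<alpha> * (2 * real n * real m + (real m)\<^sup>2)"
      by (simp add: algebra_simps power2_eq_square)
    also have "\<bar>\<dots>\<bar> \<le> (A + B * real (n+m)) + \<bar>\<alpha>\<bar> * (2 * real n * real m + (real m)\<^sup>2)"
      using AB[of "n+m"] by (intro order_trans[OF abs_triangle_ineq] add_mono) (auto simp: abs_mult)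
    finally show "\<bar>of_int (f (n+m)) - \<alpha> * (real n)\<^sup>2\<bar>
        \<le> (A + B * real m + \<bar>\<alpha>\<bar> * (real m)\<^sup>2) + (B + \<bar>\<alpha>\<bar> * 2 * real m) * real n"
      by (simp add: algebra_simps)
  qed
qed

text \<open>Descending from n in steps of \<open>q\<close> reaches one of the first \<open>q\<close>
  values, all bounded by the sum of their absolute values. Each step costs at most \<open>C\<close>,
  and there are at most n of them because \<open>q\<close> is positive.\<close>

lemma linear_growth_of_bounded_increment:
  fixes e :: "nat \<Rightarrow> real"
  assumes "q > 0" "\<And>n. \<bar>e (n + q) - e n\<bar> \<le> C"
  shows "\<exists>A. \<forall>n. \<bar>e n\<bar> \<le> A + C * real n"
proof (intro exI allI)
  have C: "C \<ge> 0" using assms(2)[of 0] by linarith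
  show "\<bar>e n\<bar> \<le> (\<Sum>i<q. \<bar>e i\<bar>) + C * real n" for n
  proof (induction n rule: less_induct)
    case (less n)
    show ?case
    proof (cases "n < q")
      case True
      then have "\<bar>e n\<bar> \<le> (\<Sum>i<q. \<bar>e i\<bar>)" by (intro member_le_sum) auto
      then show ?thesis using C by (simp add: add_increasing2)
    next
      case False
      then have "\<bar>e (n - q)\<bar> \<le> (\<Sum>i<q. \<bar>e i\<bar>) + C * real (n - q)"
        using assms(1) by (intro less.IH) auto
      moreover have "\<bar>e n - e (n - q)\<bar> \<le> C" using assms(2)[of "n - q"] False by simp
      moreover have "C * real (n - q) + C \<le> C * real n"
        using C False assms(1) mult_left_mono[of "real (n - q) + 1" "real n" C]
        by (simp add: algebra_simps of_nat_diff)
      ultimately show ?thesis by linarith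
    qed
  qed
qed

text \<open>Periodicity is the case of zero increments in the preceding bound.\<close>

lemma periodic_bounded:
  fixes H :: "nat \<Rightarrow> real"
  assumes "p > 0" "\<And>n. H (n + p) = H n"
  shows "\<exists>C. \<forall>n. \<bar>H n\<bar> \<le> C"
proof -
  have "\<bar>H (n + p) - H n\<bar> \<le> 0" for n
    unfolding assms(2) by simp
  from linear_growth_of_bounded_increment[of p H 0, OF assms(1) this] show ?thesis by simp
qed

text \<open>The increment of \<open>D\<close> over \<open>q\<close> steps is an/p plus a
  \<open>p\<close>-periodic, hence bounded, term \<open>H\<close>. Over \<open>q\<close> steps cn^2
  grows by 2cqn + cq^2, and matching the linear terms gives c = a/(2pq).\<close>

lemma quad_growth_of_periodic_increment:
  fixes D :: "nat \<Rightarrow> int" and a :: int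
  assumes p: "p > 0" and q: "q > 0"
    and per: "\<And>n. D (n + p + q) - D (n + p) = D (n + q) - D n + a"
  shows "quad_growth (of_int a / (2 * real p * real q)) D"
proof -
  define H where "H n = of_int (D (n + q) - D n) - of_int a * real n / real p" for n
  have "H (n + p) = H n" for n
  proof -
    have "real_of_int (D (n + p + q) - D (n + p)) = of_int (D (n + q) - D n) + of_int a"
      by (metis per of_int_add)
    moreover have "of_int a * real (n + p) / real p = of_int a * real n / real p + of_int a"
      using p by (simp add: field_simps)
    ultimately show ?thesis unfolding H_def by linarith
  qed
  then obtain C where C: "\<And>n. \<bar>H n\<bar> \<le> C" using periodic_bounded[OF p] by blast
  define e where "e n = of_int (D n) - of_int a / (2 * real p * real q) * (real n)\<^sup>2" for n
  \<comment> \<open>The linear terms cancel by the choice of the coefficient; the constant left over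
    is cq^2 = aq/(2p).\<close>
  have "e (n + q) - e n = H n - of_int a * real q / (2 * real p)" for n
    unfolding e_def H_def using p q by (simp add: field_simps power2_eq_square)
  then have incr: "\<bar>e (n + q) - e n\<bar> \<le> C + \<bar>of_int a * real q / (2 * real p)\<bar>" for n
    using C[of n] abs_triangle_ineq4[of "H n" "of_int a * real q / (2 * real p)"] by (simp only:)
  from linear_growth_of_bounded_increment[of q e, OF q incr] show ?thesis
    unfolding quad_growth_def e_def by blast
qed

lemma quad_growth_bigo:
  assumes "quad_growth \<alpha> f"
  shows "(\<lambda>n. of_int (f n) - \<alpha> * (real n)\<^sup>2) \<in> O(\<lambda>n. real n)"
proof -
  obtain A B where AB: "\<And>n. \<bar>of_int (f n) - \<alpha> * (real n)\<^sup>2\<bar> \<le> A + B * real n"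
    using assms by (auto simp: quad_growth_def)
  have "\<bar>of_int (f n) - \<alpha> * (real n)\<^sup>2\<bar> \<le> (\<bar>A\<bar> + B) * real n" if "n \<ge> 1" for n
  proof -
    have "A \<le> \<bar>A\<bar> * real n" using that mult_left_mono[of 1 "real n" "\<bar>A\<bar>"] by simp
    then show ?thesis using AB[of n] by (simp add: algebra_simps)
  qed
  then show ?thesis
    by (intro bigoI[of _ "\<bar>A\<bar> + B"]) (auto intro!: eventually_sequentiallyI[of 1])
qed

section \<open>From frieze orbits to growth, for a single component\<close>

text \<open>The case n + t0 = 0 (mod p) shows that the increment of E over a period, which does not
  depend on n, is the unshifted sum.\<close>

lemma periodic_sum_shift:
  fixes E F :: "nat \<Rightarrow> int"
  assumes "p > 0" and E: "\<And>n. E (Suc n) = E n + F ((n + t0) mod p)"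
  shows "E (n + p) = E n + (\<Sum>t<p. F t)"
proof -
  have const: "E (n + p) - E n = E p - E 0" for n
  proof (induction n)
    case (Suc n)
    have "(n + p + t0) mod p = (n + t0) mod p" by (metis add.assoc add.commute mod_add_self2)
    then show ?case using Suc E[of "n + p"] E[of n] by simp
  qed simp
  \<comment> \<open>A natural number for which \<open>n0 + t0\<close> is a multiple of
    \<open>p\<close>, so that the period starting at \<open>n0\<close> runs through \<open>F\<close>
    from time 0.\<close>
  define n0 where "n0 = p * t0 - t0"
  have n0: "n0 + t0 = p * t0" unfolding n0_def using \<open>p > 0\<close> by simp
  have "E (n0 + m) = E n0 + (\<Sum>t<m. F t)" if "m \<le> p" for m
    using that
  proof (induction m)
    case (Suc m)
    have "(n0 + m + t0) mod p = (m + p * t0) mod p" using n0 by (simp add: ac_simps)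
    then show ?case using Suc by (simp add: E)
  qed simp
  from this[of p] const[of n] const[of n0] show ?thesis by simp
qed

text \<open>Since the maximum is componentwise, the components of the vectors evolve independently.
  This is the system for one of them, with M = 2N - 2.\<close>

locale deformed_frieze =
  fixes M :: nat and D R S :: "nat \<Rightarrow> int" and W :: "nat \<Rightarrow> nat \<Rightarrow> int"
  assumes M_ge: "M \<ge> 3"
    and eq_D: "D (n+M+3) + D n = max (D (n+M+1) + D (n+2)) (W 2 n)"
    and eq_W2: "W 2 (n+1) + W 2 n =
        max (D (n+M+1) + D (n+M+2) + D (n+2) + D (n+3)) (W 3 n + D (n+M+3) + D (n+1))"
    and eq_Wk: "k \<in> {3..<M} \<Longrightarrow> W k (n+1) + W k n =
        max (D (n+M+1) + D (n+M+2) + D (n+k) + D (n+k+1)) (W (k-1) (n+1) + W (k+1) n)"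
    and eq_WM: "W M (n+1) + W M n =
        max (2 * D (n+M+1) + D (n+M+2) + D (n+M)) (W (M-1) (n+1) + R n + S n)"
    and eq_S: "S (n+1) + R n = max (D (n+M+1) + D (n+M+2)) (W M (n+1))"
    and eq_R: "R (n+1) + S n = max (D (n+M+1) + D (n+M+2)) (W M (n+1))"
begin

text \<open>The subtracted terms are chosen so that the first argument of every maximum becomes
  0.\<close>

definition X :: "nat \<Rightarrow> nat \<Rightarrow> int" where
  "X n k =
     (if k = 1 then D (n+M+2) + D n - D (n+M+1) - D (n+1)
      else if k \<le> M then W k n - D (n+M+1) - D (n+k)
      else if k = M + 1 then R n - D (n+M+1)
      else S n - D (n+M+1))"

lemma X_step: "frieze_step M (X n) (X (Suc n))"
  unfolding frieze_step_def
proof (intro conjI ballI)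
  show "X (Suc n) 1 + X n 1 = max 0 (X n 2)"
    using M_ge eq_D[of n] by (simp add: X_def eval_nat_numeral)
next
  fix k assume k: "k \<in> {2..<M}"
  show "X (Suc n) k + X n k = max 0 (X (Suc n) (k - 1) + X n (k + 1))"
  proof (cases "k = 2")
    \<comment> \<open>Here the left neighbour is node 1: the terms D(n+M+3) + D(n+1) of
      \<open>eq_W2\<close>, after normalisation, give \<open>X (Suc n) 1\<close>.\<close>
    case True
    then show ?thesis
      using M_ge eq_W2[of n] by (simp add: X_def eval_nat_numeral)
  next
    case False
    then have "k \<in> {3..<M}" "Suc (n + (k - 1)) = n + k" "k - 1 \<noteq> 1" "k - 1 \<le> M"
      using k by auto
    then show ?thesis
      using eq_Wk[of k n] by (simp add: X_def)
  qed
next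
  have "Suc (n + (M - 1)) = n + M" "M - 1 \<noteq> 1" using M_ge by auto
  then show "X (Suc n) M + X n M = max 0 (X (Suc n) (M - 1) + X n (M + 1) + X n (M + 2))"
    using M_ge eq_WM[of n] by (simp add: X_def)
  show "X (Suc n) (M + 2) + X n (M + 1) = max 0 (X (Suc n) M)"
    using M_ge eq_S[of n] by (simp add: X_def)
  show "X (Suc n) (M + 1) + X n (M + 2) = max 0 (X (Suc n) M)"
    using M_ge eq_R[of n] by (simp add: X_def)
qed

text \<open>All kinds of initial data pass through this lemma; only those coming from d use a
  nonzero \<open>t0\<close>. The rate comes from period \<open>M + 2\<close> and step
  \<open>M + 1\<close>, and it doubles for \<open>W k\<close>, which involves two shifts of
  \<open>D\<close>.\<close>

lemma growth_of_orbit: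
  assumes U: "\<And>t. t < M + 2 \<Longrightarrow> frieze_step M (U t) (U (Suc t mod (M + 2)))"
    and bound: "\<And>t k. \<bar>U t k\<bar> \<le> 2"
    and sum: "(\<Sum>t<M+2. U t 1) = a"
    and init: "\<And>k. k \<in> {1..M+2} \<Longrightarrow> X 0 k = U (t0 mod (M + 2)) k"
    and \<alpha>: "\<alpha> = of_int a / (2 * real (M + 2) * real (M + 1))"
  shows "quad_growth \<alpha> D" "quad_growth \<alpha> R" "quad_growth \<alpha> S"
    "k \<in> {2..M} \<Longrightarrow> quad_growth (2 * \<alpha>) (W k)"
proof -
  have X: "X n k = U ((n + t0) mod (M + 2)) k" if "k \<in> {1..M+2}" for n k
    using frieze_orbit[of M X "M + 2" U t0, OF _ X_step U _ init that] M_ge by simp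
  define E where "E n = D (n+M+1) - D n" for n
  have "E (Suc n) = E n + U ((n + t0) mod (M + 2)) 1" for n
    using X[of 1 n] by (simp add: E_def X_def)
  from periodic_sum_shift[of "M + 2" E "\<lambda>t. U t 1", OF _ this]
  have E: "E (n + (M + 2)) = E n + a" for n
    using sum by simp
  show D: "quad_growth \<alpha> D"
    unfolding \<alpha>
  proof (rule quad_growth_of_periodic_increment)
    show "D (n + (M + 2) + (M + 1)) - D (n + (M + 2)) = D (n + (M + 1)) - D n + a" for n
      using E[of n] by (simp add: E_def add.assoc)
  qed simp_all
  have X_bounded: "quad_growth 0 (\<lambda>n. X n k)" if "k \<in> {1..M+2}" for k
    using bound by (intro quad_growth_bounded[of _ 2]) (simp add: X[OF that])
  note shift = quad_growth_shift[OF D]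
  have "R = (\<lambda>n. X n (M + 1) + D (n + (M + 1)))" using M_ge by (simp add: X_def fun_eq_iff)
  then show "quad_growth \<alpha> R"
    using quad_growth_add[OF X_bounded[of "M + 1"] shift[of "M + 1"]] by simp
  have "S = (\<lambda>n. X n (M + 2) + D (n + (M + 1)))" using M_ge by (simp add: X_def fun_eq_iff)
  then show "quad_growth \<alpha> S"
    using quad_growth_add[OF X_bounded[of "M + 2"] shift[of "M + 1"]] by simp
  show "quad_growth (2 * \<alpha>) (W k)" if "k \<in> {2..M}"
  proof -
    have "W k = (\<lambda>n. X n k + (D (n + (M + 1)) + D (n + k)))"
      using that by (simp add: X_def fun_eq_iff)
    then show ?thesis
      using quad_growth_add[OF X_bounded[of k] quad_growth_add[OF shift[of "M + 1"] shift[of k]]] that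
      by simp
  qed
qed

text \<open>All the states arising from a unit vector in d lie on the same orbit, at time M + 2 - m.\<close>

lemma growth_init_D:
  assumes "m \<le> M + 2"
    and "\<And>i. i \<le> M + 2 \<Longrightarrow> D i = - of_bool (i = m)" "R 0 = 0" "S 0 = 0"
    and "\<And>k. k \<in> {2..M} \<Longrightarrow> W k 0 = 0"
    and \<alpha>: "\<alpha> = 1 / (2 * real (M + 2) * real (M + 1))"
  shows "quad_growth \<alpha> D" "quad_growth \<alpha> R" "quad_growth \<alpha> S"
    "k \<in> {2..M} \<Longrightarrow> quad_growth (2 * \<alpha>) (W k)"
proof -
  have "X 0 k = end_orbit M ((M + 2 - m) mod (M + 2)) k" if "k \<in> {1..M+2}" for k
  proof -
    \<comment> \<open>The initial state is minus the unit vector at node 1 in the first case, 1 at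
      every node in the second, and the unit vector at node \<open>m\<close> in the third. These are
      the times 0, 1 and \<open>M + 2 - m\<close> of the orbit.\<close>
    consider "m = 0 \<or> m = M + 2" | "m = M + 1" | "1 \<le> m" "m \<le> M" using assms(1) by linarith
    then show ?thesis
    proof cases
      case 1
      then have "(M + 2 - m) mod (M + 2) = 0" by auto
      then show ?thesis using 1 assms(2-5) that M_ge by (auto simp: X_def end_orbit_def)
    next
      case 2
      then have "(M + 2 - m) mod (M + 2) = 1" by auto
      then show ?thesis using 2 assms(2-5) that M_ge by (simp add: X_def end_orbit_def)
    next
      case 3
      define t where "t = M + 2 - m"
      have t: "t \<ge> 2" "k + t = M + 2 \<longleftrightarrow> k = m" and mod: "(M + 2 - m) mod (M + 2) = t"
        using 3 by (auto simp: t_def)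
      have "X 0 k = of_bool (k = m)" using 3 assms(2-5) that M_ge by (simp add: X_def)
      also have "\<dots> = end_orbit M t k" using t by (simp add: end_orbit_def)
      finally show ?thesis unfolding mod .
    qed
  qed
  note * = growth_of_orbit[OF frieze_step_end_orbit orbit_bounded(1) sum_end_orbit this, of \<alpha>]
  show "quad_growth \<alpha> D" "quad_growth \<alpha> R" "quad_growth \<alpha> S"
    "k \<in> {2..M} \<Longrightarrow> quad_growth (2 * \<alpha>) (W k)"
    using M_ge \<alpha> by (intro *; simp)+
qed

text \<open>As \<open>D\<close> vanishes initially, nothing is subtracted in \<open>X 0\<close>,
  which is therefore minus the unit vector at the spin node \<open>j\<close>.\<close>

lemma growth_init_RS:
  assumes "j \<in> {M+1, M+2}"
    and "\<And>i. i \<le> M + 2 \<Longrightarrow> D i = 0" "R 0 = - of_bool (j = M+1)" "S 0 = - of_bool (j = M+2)"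
    and "\<And>k. k \<in> {2..M} \<Longrightarrow> W k 0 = 0"
    and \<alpha>: "\<alpha> = 1 / (2 * real (M + 2) * real (M + 1))"
  shows "quad_growth \<alpha> D" "quad_growth \<alpha> R" "quad_growth \<alpha> S"
    "k \<in> {2..M} \<Longrightarrow> quad_growth (2 * \<alpha>) (W k)"
proof -
  have "X 0 k = spin_orbit M j (0 mod (M + 2)) k" if "k \<in> {1..M+2}" for k
    using assms(1-5) that M_ge by (auto simp: X_def spin_orbit_def)
  note * = growth_of_orbit[OF frieze_step_spin_orbit orbit_bounded(2) sum_spin_orbit this, of \<alpha>]
  show "quad_growth \<alpha> D" "quad_growth \<alpha> R" "quad_growth \<alpha> S"
    "k \<in> {2..M} \<Longrightarrow> quad_growth (2 * \<alpha>) (W k)"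
    using M_ge \<alpha> assms(1) by (intro *; auto)+
qed

text \<open>Again \<open>X 0\<close> is minus a unit vector, now at an inner node; the period sum 2
  doubles the rate.\<close>

lemma growth_init_W:
  assumes "j \<in> {2..M}"
    and "\<And>i. i \<le> M + 2 \<Longrightarrow> D i = 0" "R 0 = 0" "S 0 = 0"
    and "\<And>k. k \<in> {2..M} \<Longrightarrow> W k 0 = - of_bool (k = j)"
    and \<alpha>: "\<alpha> = 2 / (2 * real (M + 2) * real (M + 1))"
  shows "quad_growth \<alpha> D" "quad_growth \<alpha> R" "quad_growth \<alpha> S"
    "k \<in> {2..M} \<Longrightarrow> quad_growth (2 * \<alpha>) (W k)"
proof -
  have "X 0 k = inner_orbit M j (0 mod (M + 2)) k" if "k \<in> {1..M+2}" for k
    using assms(1-5) that M_ge by (auto simp: X_def inner_orbit_def)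
  note * = growth_of_orbit[OF frieze_step_inner_orbit orbit_bounded(3) sum_inner_orbit this, of \<alpha>]
  show "quad_growth \<alpha> D" "quad_growth \<alpha> R" "quad_growth \<alpha> S"
    "k \<in> {2..M} \<Longrightarrow> quad_growth (2 * \<alpha>) (W k)"
    using M_ge \<alpha> assms(1) by (intro *; auto)+
qed

end

section \<open>Positions in the list of initial vectors\<close>

lemma length_initial_vecs:
  assumes "N \<ge> 3"
  shows "length (initial_vecs N d f g h r s) = 4 * N"
  using assms by (simp add: initial_vecs_def)

text \<open>The blocks have lengths N - 2, 2, 2N + 1, 1 and N - 2, and positions count from 0. The
  h-block is in reverse order.\<close>

lemma nth_initial_vecs:
  assumes "N \<ge> 3"
  shows "i \<in> {1..N-2} \<Longrightarrow> initial_vecs N d f g h r s ! (N - 2 - i) = h i 0"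
    and "initial_vecs N d f g h r s ! (N - 2) = r 0"
    and "initial_vecs N d f g h r s ! (N - 1) = s 0"
    and "m \<le> 2 * N \<Longrightarrow> initial_vecs N d f g h r s ! (N + m) = d m"
    and "initial_vecs N d f g h r s ! (3 * N + 1) = f 0"
    and "i \<in> {1..N-2} \<Longrightarrow> initial_vecs N d f g h r s ! (3 * N + 1 + i) = g i 0"
proof -
  define hs where "hs = map (\<lambda>i. h i 0) (rev [1..<N-1])"
  define ds where "ds = map d [0..<2*N+1]"
  define gs where "gs = map (\<lambda>i. g i 0) [1..<N-1]"
  have len: "length hs = N - 2" "length ds = 2 * N + 1" "length gs = N - 2"
    by (simp_all add: hs_def ds_def gs_def)
  have eq: "initial_vecs N d f g h r s = hs @ [r 0, s 0] @ ds @ [f 0] @ gs"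
    by (simp add: initial_vecs_def hs_def ds_def gs_def)
  show "initial_vecs N d f g h r s ! (N - 2 - i) = h i 0" if "i \<in> {1..N-2}"
  proof -
    have lt: "N - 2 - i < N - 2" using that by auto
    have "hs ! (N - 2 - i) = h (rev [1..<N-1] ! (N - 2 - i)) 0"
      unfolding hs_def using lt by (intro nth_map) simp
    also have "rev [1..<N-1] ! (N - 2 - i) = [1..<N-1] ! (i - 1)"
      using lt that by (subst rev_nth) auto
    also have "\<dots> = i" using that by (subst nth_upt) auto
    finally have "hs ! (N - 2 - i) = h i 0" .
    then show ?thesis using lt unfolding eq by (simp add: nth_append len)
  qed
  show "initial_vecs N d f g h r s ! (N - 2) = r 0"
    unfolding eq by (simp add: nth_append len)
  show "initial_vecs N d f g h r s ! (N - 1) = s 0"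
  proof -
    have "N - 1 = length hs + 1" using assms by (simp add: len)
    then show ?thesis unfolding eq by (simp only: nth_append_length_plus) simp
  qed
  show "initial_vecs N d f g h r s ! (N + m) = d m" if "m \<le> 2 * N"
  proof -
    have "(hs @ [r 0, s 0]) @ ds @ [f 0] @ gs = initial_vecs N d f g h r s" by (simp add: eq)
    moreover have "length (hs @ [r 0, s 0]) = N" using assms by (simp add: len)
    moreover have "(ds @ [f 0] @ gs) ! m = d m"
      using that by (simp add: nth_append len) (simp add: ds_def del: upt_Suc)
    ultimately show ?thesis by (metis nth_append_length_plus)
  qed
  have pre: "(hs @ [r 0, s 0] @ ds) @ [f 0] @ gs = initial_vecs N d f g h r s"
    "length (hs @ [r 0, s 0] @ ds) = 3 * N + 1"
    using assms by (simp_all add: eq len)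
  show "initial_vecs N d f g h r s ! (3 * N + 1) = f 0"
    using nth_append_length_plus[of "hs @ [r 0, s 0] @ ds" "[f 0] @ gs" 0] unfolding pre by simp
  show "initial_vecs N d f g h r s ! (3 * N + 1 + i) = g i 0" if "i \<in> {1..N-2}"
  proof -
    have "[1..<N-1] ! (i - 1) = i" using that by (subst nth_upt) auto
    moreover have "i - 1 < length [1..<N-1]" using that by auto
    ultimately have "gs ! (i - 1) = g i 0" unfolding gs_def by (simp only: nth_map)
    then have "([f 0] @ gs) ! i = g i 0" using that by (simp add: nth_Cons')
    then show ?thesis
      using nth_append_length_plus[of "hs @ [r 0, s 0] @ ds" "[f 0] @ gs" i] unfolding pre by simp
  qed
qed

section \<open>Assembling the components into the vector statement\<close>

lemma vec_max_index:
  "i < dim_vec u \<Longrightarrow> vec_max u v $ i = max (u $ i) (v $ i)"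
  by (simp add: vec_max_def)

lemma vec_bigo_of_quad_growth:
  assumes "\<And>n. u n \<in> carrier_vec m" "b \<in> carrier_vec m"
    and "\<And>j. j < m \<Longrightarrow> quad_growth (c * b $ j) (\<lambda>n. u n $ j)"
  shows "(\<lambda>n. map_vec real_of_int (u n) - ((real n)^2 * c) \<cdot>\<^sub>v b) \<in> vec_bigo m (\<lambda>n. real n)"
  unfolding vec_bigo_def
proof (intro CollectI conjI allI impI)
  show "map_vec real_of_int (u n) - ((real n)^2 * c) \<cdot>\<^sub>v b \<in> carrier_vec m" for n
    using assms(1,2) by auto
  fix j assume j: "j < m"
  have "(map_vec real_of_int (u n) - ((real n)^2 * c) \<cdot>\<^sub>v b) $ j
      = of_int (u n $ j) - c * b $ j * (real n)^2" for n
    using assms(1)[of n] assms(2) j by simp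
  then show "(\<lambda>n. (map_vec real_of_int (u n) - ((real n)^2 * c) \<cdot>\<^sub>v b) $ j) \<in> O(\<lambda>n. real n)"
    using quad_growth_bigo[OF assms(3)[OF j]] by simp
qed

theorem theorem7p1:
  fixes N :: nat
    and d f r s :: "nat \<Rightarrow> int vec"
    and g h w :: "nat \<Rightarrow> nat \<Rightarrow> int vec"
  assumes N: "N \<ge> 3"
    and carrier:
      "\<And>n. d n \<in> carrier_vec (4*N)" "\<And>n. f n \<in> carrier_vec (4*N)"
      "\<And>n. r n \<in> carrier_vec (4*N)" "\<And>n. s n \<in> carrier_vec (4*N)"
      "\<And>i n. i \<in> {1..N-2} \<Longrightarrow> g i n \<in> carrier_vec (4*N)"
      "\<And>i n. i \<in> {1..N-2} \<Longrightarrow> h i n \<in> carrier_vec (4*N)"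
    and w:
      "\<And>n. w 2 n = f n"
      "\<And>k n. k \<in> {3..N} \<Longrightarrow> w k n = g (k-2) n"
      "\<And>k n. k \<in> {N+1..2*N-2} \<Longrightarrow> w k n = h (2*N-1-k) n"
    and eq_d: "\<And>n. d (n+2*N+1) + d n = vec_max (d (n+2*N-1) + d (n+2)) (w 2 n)"
    and eq_w2: "\<And>n. w 2 (n+1) + w 2 n =
        vec_max (d (n+2*N-1) + d (n+2*N) + d (n+2) + d (n+3)) (w 3 n + d (n+2*N+1) + d (n+1))"
    and eq_wk: "\<And>k n. k \<in> {3..2*N-3} \<Longrightarrow> w k (n+1) + w k n =
        vec_max (d (n+2*N-1) + d (n+2*N) + d (n+k) + d (n+k+1)) (w (k-1) (n+1) + w (k+1) n)"
    and eq_wlast: "\<And>n. w (2*N-2) (n+1) + w (2*N-2) n =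
        vec_max (2 \<cdot>\<^sub>v d (n+2*N-1) + d (n+2*N) + d (n+2*N-2)) (w (2*N-3) (n+1) + r n + s n)"
    and eq_s: "\<And>n. s (n+1) + r n = vec_max (d (n+2*N-1) + d (n+2*N)) (w (2*N-2) (n+1))"
    and eq_r: "\<And>n. r (n+1) + s n = vec_max (d (n+2*N-1) + d (n+2*N)) (w (2*N-2) (n+1))"
    and init: "mat_of_cols (4*N) (initial_vecs N d f g h r s) = - 1\<^sub>m (4*N)"
  shows
    "(\<lambda>n. map_vec real_of_int (d n) - ((real n)^2 / (8 * (real N)^2 - 4 * real N)) \<cdot>\<^sub>v a_vec N)
       \<in> vec_bigo (4*N) (\<lambda>n. real n) \<and>
     (\<lambda>n. map_vec real_of_int (r n) - ((real n)^2 / (8 * (real N)^2 - 4 * real N)) \<cdot>\<^sub>v a_vec N)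
       \<in> vec_bigo (4*N) (\<lambda>n. real n) \<and>
     (\<lambda>n. map_vec real_of_int (s n) - ((real n)^2 / (8 * (real N)^2 - 4 * real N)) \<cdot>\<^sub>v a_vec N)
       \<in> vec_bigo (4*N) (\<lambda>n. real n) \<and>
     (\<lambda>n. map_vec real_of_int (f n) - ((real n)^2 / (4 * (real N)^2 - 2 * real N)) \<cdot>\<^sub>v a_vec N)
       \<in> vec_bigo (4*N) (\<lambda>n. real n) \<and>
     (\<forall>i\<in>{1..N-2}.
       (\<lambda>n. map_vec real_of_int (h i n) - ((real n)^2 / (4 * (real N)^2 - 2 * real N)) \<cdot>\<^sub>v a_vec N)
         \<in> vec_bigo (4*N) (\<lambda>n. real n) \<and>
       (\<lambda>n. map_vec real_of_int (g i n) - ((real n)^2 / (4 * (real N)^2 - 2 * real N)) \<cdot>\<^sub>v a_vec N)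
         \<in> vec_bigo (4*N) (\<lambda>n. real n))"
proof -
  \<comment> \<open>The diagram of type D_2N has M + 2 = 2N nodes.\<close>
  define M where "M = 2 * N - 2"
  have M: "M \<ge> 3" "2 * N = M + 2" "2 * N - 2 = M" "2 * N - 3 = M - 1"
    using N by (auto simp: M_def)
  \<comment> \<open>The rate for an entry 1 of \<open>a_vec\<close>, as 8N^2 - 4N = 2(2N)(2N -
    1).\<close>
  define \<alpha> :: real where "\<alpha> = 1 / (8 * (real N)^2 - 4 * real N)"
  have \<alpha>: "\<alpha> = 1 / (2 * real (M + 2) * real (M + 1))"
  proof -
    have eq: "real (M + 2) = 2 * real N" "real (M + 1) = 2 * real N - 1"
      using N by (simp_all add: M_def)
    show ?thesis unfolding \<alpha>_def eq by (simp add: power2_eq_square algebra_simps)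
  qed
  have dim: "dim_vec (d n) = 4 * N" "dim_vec (r n) = 4 * N" "dim_vec (s n) = 4 * N" for n
    using carrier by (auto dest: carrier_vecD)
  have w_cases [consumes 1]: thesis
    if "k \<in> {2..M}" "k = 2 \<Longrightarrow> thesis" "k \<in> {3..N} \<Longrightarrow> thesis" "k \<in> {N+1..2*N-2} \<Longrightarrow> thesis"
    for k thesis
  proof -
    have "k = 2 \<or> k \<in> {3..N} \<or> k \<in> {N+1..2*N-2}"
      using that(1) M(3) unfolding atLeastAtMost_iff by linarith
    then show thesis using that(2-4) by blast
  qed
  have w_carrier: "w k n \<in> carrier_vec (4 * N)" if k: "k \<in> {2..M}" for k n
  proof -
    from k show ?thesis
    proof (cases rule: w_cases)
      case 1
      then show ?thesis using w(1) carrier(2) by simp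
    next
      case 2
      then have "k - 2 \<in> {1..N-2}" by auto
      then show ?thesis using w(2)[OF 2] carrier(5) by simp
    next
      case 3
      then have "2 * N - 1 - k \<in> {1..N-2}" by auto
      then show ?thesis using w(3)[OF 3] carrier(6) by simp
    qed
  qed
  then have dim_w: "dim_vec (w k n) = 4 * N" if "k \<in> {2..M}" for k n
    using that by (auto dest: carrier_vecD)
  have growth: "quad_growth (\<alpha> * a_vec N $ c) (\<lambda>n. d n $ c) \<and>
      quad_growth (\<alpha> * a_vec N $ c) (\<lambda>n. r n $ c) \<and>
      quad_growth (\<alpha> * a_vec N $ c) (\<lambda>n. s n $ c) \<and>
      (\<forall>k\<in>{2..M}. quad_growth (2 * \<alpha> * a_vec N $ c) (\<lambda>n. w k n $ c))" if c: "c < 4 * N" for c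
  proof -
    interpret deformed_frieze M "\<lambda>n. d n $ c" "\<lambda>n. r n $ c" "\<lambda>n. s n $ c" "\<lambda>k n. w k n $ c"
    proof
      \<comment> \<open>Removes the truncated subtractions from the indices.\<close>
      have idx: "n + 2 * N - 1 = n + M + 1" "n + 2 * N = n + M + 2" "n + 2 * N + 1 = n + M + 3"
        "n + 2 * N - 2 = n + M" for n
        using M by auto
      show "M \<ge> 3" by (fact M)
      fix n k
      note comp = vec_max_index dim dim_w c M(1)
      show "d (n+M+3) $ c + d n $ c = max (d (n+M+1) $ c + d (n+2) $ c) (w 2 n $ c)"
        using arg_cong[OF eq_d[of n, unfolded idx], of "\<lambda>v. v $ c"]
        by (simp add: comp numeral_3_eq_3)
      show "w 2 (n+1) $ c + w 2 n $ c =
        max (d (n+M+1) $ c + d (n+M+2) $ c + d (n+2) $ c + d (n+3) $ c)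
          (w 3 n $ c + d (n+M+3) $ c + d (n+1) $ c)"
        using arg_cong[OF eq_w2[of n, unfolded idx], of "\<lambda>v. v $ c"] M(1)
        by (simp add: comp numeral_3_eq_3)
      show "w k (n+1) $ c + w k n $ c =
        max (d (n+M+1) $ c + d (n+M+2) $ c + d (n+k) $ c + d (n+k+1) $ c)
          (w (k-1) (n+1) $ c + w (k+1) n $ c)" if "k \<in> {3..<M}"
      proof -
        have "k \<in> {3..2*N-3}" "k \<in> {2..M}" "k - 1 \<in> {2..M}" "k + 1 \<in> {2..M}" using that M by auto
        then show ?thesis
          using arg_cong[OF eq_wk[of k n, unfolded idx], of "\<lambda>v. v $ c"]
          by (simp add: vec_max_index dim dim_w c del: atLeastAtMost_iff)
      qed
      have "M - 1 \<in> {2..M}" "M \<in> {2..M}" using M by auto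
      then show "w M (n+1) $ c + w M n $ c =
        max (2 * d (n+M+1) $ c + d (n+M+2) $ c + d (n+M) $ c)
          (w (M-1) (n+1) $ c + r n $ c + s n $ c)"
        using arg_cong[OF eq_wlast[of n, unfolded idx M(3,4)], of "\<lambda>v. v $ c"]
        by (simp add: vec_max_index dim dim_w c del: atLeastAtMost_iff)
      show "s (n+1) $ c + r n $ c = max (d (n+M+1) $ c + d (n+M+2) $ c) (w M (n+1) $ c)"
        using arg_cong[OF eq_s[of n, unfolded idx M(3)], of "\<lambda>v. v $ c"] by (simp add: comp)
      show "r (n+1) $ c + s n $ c = max (d (n+M+1) $ c + d (n+M+2) $ c) (w M (n+1) $ c)"
        using arg_cong[OF eq_r[of n, unfolded idx M(3)], of "\<lambda>v. v $ c"] by (simp add: comp)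
    qed
    \<comment> \<open>Row \<open>c\<close> of the matrix lists component \<open>c\<close> of all
      initial vectors; it is -1 at position \<open>c\<close> and 0 elsewhere.\<close>
    have entry: "initial_vecs N d f g h r s ! j $ c = - of_bool (c = j)" if "j < 4 * N" for j
      using arg_cong[OF init, of "\<lambda>A. A $$ (c, j)"] that c N
      by (auto simp: mat_of_cols_index length_initial_vecs)
    have d0: "d m $ c = - of_bool (c = N + m)" if "m \<le> M + 2" for m
    proof -
      have "m \<le> 2 * N" "N + m < 4 * N" using that M(2) N by linarith+
      then show ?thesis using entry[of "N + m"] nth_initial_vecs(4)[OF N, of m d f g h r s] by simp
    qed
    have r0: "r 0 $ c = - of_bool (c + 2 = N)"
    proof -
      have "c = N - 2 \<longleftrightarrow> c + 2 = N" "N - 2 < 4 * N" using N by linarith+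
      then show ?thesis using entry[of "N - 2"] nth_initial_vecs(2)[OF N, of d f g h r s] by simp
    qed
    have s0: "s 0 $ c = - of_bool (c + 1 = N)"
    proof -
      have "c = N - 1 \<longleftrightarrow> c + 1 = N" "N - 1 < 4 * N" using N by linarith+
      then show ?thesis using entry[of "N - 1"] nth_initial_vecs(3)[OF N, of d f g h r s] by simp
    qed
    \<comment> \<open>The vector w_k sits at position 3N + k - 1 for k at most N and at position k -
      N - 1 otherwise; both are written additively to avoid truncated subtraction.\<close>
    have w0: "w k 0 $ c = - of_bool (if k \<le> N then c + 1 = 3 * N + k else c + N + 1 = k)"
      if k: "k \<in> {2..M}" for k
      using k
    proof (cases rule: w_cases)
      case 1
      have "3 * N + 1 < 4 * N" using N by linarith
      then show ?thesis
        using 1 w(1) entry[of "3 * N + 1"] nth_initial_vecs(5)[OF N, of d f g h r s] N by simp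
    next
      case 2
      then have i: "k - 2 \<in> {1..N-2}" and k2: "k = (k - 2) + 2" by auto
      have lt: "3 * N + 1 + (k - 2) < 4 * N" using i N unfolding atLeastAtMost_iff by linarith
      have "c = 3 * N + 1 + (k - 2) \<longleftrightarrow> c + 1 = 3 * N + k" using k2 by linarith
      then have "g (k - 2) 0 $ c = - of_bool (c + 1 = 3 * N + k)"
        using entry[OF lt] unfolding nth_initial_vecs(6)[OF N i] by (simp only:)
      then show ?thesis unfolding w(2)[OF 2] using 2 by simp
    next
      case 3
      then have i: "2 * N - 1 - k \<in> {1..N-2}" by auto
      have lt: "N - 2 - (2 * N - 1 - k) < 4 * N" using N by linarith
      have "c = N - 2 - (2 * N - 1 - k) \<longleftrightarrow> c + N + 1 = k"
        using 3 unfolding atLeastAtMost_iff by linarith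
      then have "h (2 * N - 1 - k) 0 $ c = - of_bool (c + N + 1 = k)"
        using entry[OF lt] unfolding nth_initial_vecs(1)[OF N i] by (simp only:)
      then show ?thesis unfolding w(3)[OF 3] using 3 by simp
    qed
    \<comment> \<open>Position \<open>c\<close> carries the entry a_{c+1}, which is 1 in the d-block
      and at r and s, and 2 at the vectors w_k.\<close>
    consider (D) "N \<le> c" "c \<le> 3 * N"
      | (RS) "c + 2 = N \<or> c + 1 = N" | (W) "c + 2 < N \<or> 3 * N + 1 \<le> c"
      by linarith
    then show ?thesis
    proof cases
      case D
      then have a: "a_vec N $ c = 1" using c N by (auto simp: a_vec_def)
      have m: "c - N \<le> M + 2" using D M(2) by linarith
      have "d i $ c = - of_bool (i = c - N)" if "i \<le> M + 2" for i
        using d0[OF that] D(1) by auto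
      moreover have "r 0 $ c = 0" "s 0 $ c = 0" using r0 s0 D(1) by auto
      moreover have "w k 0 $ c = 0" if "k \<in> {2..M}" for k
      proof -
        have "c + 1 \<noteq> 3 * N + k" "c + N + 1 \<noteq> k"
          using that D M(2) unfolding atLeastAtMost_iff by linarith+
        then show ?thesis using w0[OF that] by simp
      qed
      ultimately show ?thesis
        using growth_init_D[OF m _ _ _ _ \<alpha>] by (simp add: a)
    next
      case RS
      define j where "j = (if c + 2 = N then M + 1 else M + 2)"
      have a: "a_vec N $ c = 1" using RS c N by (auto simp: a_vec_def)
      have j: "j \<in> {M+1, M+2}" by (simp add: j_def)
      have "d i $ c = 0" if "i \<le> M + 2" for i
        using d0[OF that] RS by auto
      moreover have "r 0 $ c = - of_bool (j = M+1)" "s 0 $ c = - of_bool (j = M+2)"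
        using r0 s0 RS by (auto simp: j_def)
      moreover have "w k 0 $ c = 0" if "k \<in> {2..M}" for k
      proof -
        have "c + 1 \<noteq> 3 * N + k" "c + N + 1 \<noteq> k"
          using that RS M(2) unfolding atLeastAtMost_iff by linarith+
        then show ?thesis using w0[OF that] by simp
      qed
      ultimately show ?thesis
        using growth_init_RS[OF j _ _ _ _ \<alpha>] by (simp add: a)
    next
      case W
      \<comment> \<open>The inverse of the positions in \<open>w0\<close>: the node whose initial
        vector has the entry -1 in component \<open>c\<close>.\<close>
      define j where "j = (if c + 2 < N then c + N + 1 else c + 1 - 3 * N)"
      have j_eq: "c + 2 < N \<and> j = c + N + 1 \<or> 3 * N + 1 \<le> c \<and> j + 3 * N = c + 1"
        using W by (auto simp: j_def)
      have a: "a_vec N $ c = 2" using W c N by (auto simp: a_vec_def)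
      have j: "j \<in> {2..M}" using j_eq c M(2) N unfolding atLeastAtMost_iff by linarith
      have "d i $ c = 0" if "i \<le> M + 2" for i
        using d0[OF that] that M(2) W by auto
      moreover have "r 0 $ c = 0" "s 0 $ c = 0"
        using r0 s0 W by auto
      moreover have "w k 0 $ c = - of_bool (k = j)" if "k \<in> {2..M}" for k
      proof -
        have "(if k \<le> N then c + 1 = 3 * N + k else c + N + 1 = k) \<longleftrightarrow> k = j"
          using j_eq c that M(2) unfolding atLeastAtMost_iff
          by (cases "k \<le> N"; simp only: if_True if_False; linarith)
        then show ?thesis using w0[OF that] by simp
      qed
      moreover have "2 * \<alpha> = 2 / (2 * real (M + 2) * real (M + 1))" using \<alpha> by simp
      ultimately show ?thesis
        using growth_init_W[OF j, of "2 * \<alpha>"] by (simp add: a mult.commute)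
    qed
  qed
  have a: "a_vec N \<in> carrier_vec (4 * N)" by (simp add: a_vec_def)
  have c1: "x / (8 * (real N)^2 - 4 * real N) = x * \<alpha>" for x
    by (simp add: \<alpha>_def)
  have c2: "x / (4 * (real N)^2 - 2 * real N) = x * (2 * \<alpha>)" for x
  proof -
    \<comment> \<open>The denominator for f, g and h is half of the other, so its reciprocal is
      \<open>2 * \<alpha>\<close>.\<close>
    have "8 * (real N)^2 - 4 * real N = 2 * (4 * (real N)^2 - 2 * real N)" by simp
    moreover have "x / A = x * (2 * (1 / (2 * A)))" for A :: real by simp
    ultimately show ?thesis unfolding \<alpha>_def by metis
  qed
  have w_growth: "(\<lambda>n. map_vec real_of_int (w k n) - ((real n)^2 * (2 * \<alpha>)) \<cdot>\<^sub>v a_vec N)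
      \<in> vec_bigo (4*N) (\<lambda>n. real n)" if "k \<in> {2..M}" for k
    by (rule vec_bigo_of_quad_growth[OF w_carrier[OF that] a]) (use that growth in blast)
  show ?thesis
    unfolding c1 c2
  proof (intro conjI ballI)
    show "(\<lambda>n. map_vec real_of_int (d n) - ((real n)^2 * \<alpha>) \<cdot>\<^sub>v a_vec N)
        \<in> vec_bigo (4*N) (\<lambda>n. real n)"
      by (rule vec_bigo_of_quad_growth[OF carrier(1) a]) (use growth in blast)
    show "(\<lambda>n. map_vec real_of_int (r n) - ((real n)^2 * \<alpha>) \<cdot>\<^sub>v a_vec N)
        \<in> vec_bigo (4*N) (\<lambda>n. real n)"
      by (rule vec_bigo_of_quad_growth[OF carrier(3) a]) (use growth in blast)
    show "(\<lambda>n. map_vec real_of_int (s n) - ((real n)^2 * \<alpha>) \<cdot>\<^sub>v a_vec N)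
        \<in> vec_bigo (4*N) (\<lambda>n. real n)"
      by (rule vec_bigo_of_quad_growth[OF carrier(4) a]) (use growth in blast)
    show "(\<lambda>n. map_vec real_of_int (f n) - ((real n)^2 * (2 * \<alpha>)) \<cdot>\<^sub>v a_vec N)
        \<in> vec_bigo (4*N) (\<lambda>n. real n)"
      using w_growth[of 2] w(1) M by simp
    fix i assume i: "i \<in> {1..N-2}"
    \<comment> \<open>Inverts the indexing of w: g_i is w_{i+2} and h_i is w_{2N-1-i}.\<close>
    then have g: "i + 2 \<in> {3..N}" "i + 2 \<in> {2..M}"
      and h: "2 * N - 1 - i \<in> {N+1..2*N-2}"
        "2 * N - 1 - i \<in> {2..M}" "2 * N - 1 - (2 * N - 1 - i) = i"
      using M N by auto
    show "(\<lambda>n. map_vec real_of_int (g i n) - ((real n)^2 * (2 * \<alpha>)) \<cdot>\<^sub>v a_vec N)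
        \<in> vec_bigo (4*N) (\<lambda>n. real n)"
      using w_growth[OF g(2)] w(2)[OF g(1)] by simp
    show "(\<lambda>n. map_vec real_of_int (h i n) - ((real n)^2 * (2 * \<alpha>)) \<cdot>\<^sub>v a_vec N)
        \<in> vec_bigo (4*N) (\<lambda>n. real n)"
      using w_growth[OF h(2)] w(3)[OF h(1)] h(3) by simp
  qed
qed

end
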